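(* Let $F=\{f_i\}_{i=1}^\infty$ be a Besselian frame for a Hilbert space $\mathcal{H}$. Then the following are equivalent: (i) $F$ is robust to $1$-erasure; (ii) there exists a sequence of scalars $\{a_i\}_{i=1}^\infty\in\ell^2$ with $a_i\neq0$ for every $i$ such that $\sum_{i=1}^\infty a_if_i=0$.
   Context: A sequence $\{f_i\}_{i\in I}$ in a Hilbert space $\mathcal{H}$ ($I$ countable) is a frame for $\mathcal{H}$ if there are constants $A,B>0$ with $A\|f\|^2\le\sum_{i\in I}|\langle f,f_i\rangle|^2\le B\|f\|^2$ for all $f\in\mathcal{H}$. A frame $\{f_i\}_{i=1}^\infty$ is Besselian if, whenever $\sum_{i=1}^\infty a_if_i$ converges in norm for a scalar sequence $\{a_i\}$, then $\{a_i\}\in\ell^2$. A frame $\{f_i\}_{i=1}^\infty$ for $\mathcal{H}$ is robust to $1$-erasure if for every $m\in\mathbb{N}$ the family $\{f_i\}_{i\ne m}$ is a frame for $\mathcal{H}$. *)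

theory Defs
  imports "HOL-Analysis.Analysis"
begin

text \<open>
  The scalar field of a Hilbert space is the reals or the complex numbers. The following class
  has exactly these two models up to isometric isomorphism: expanding
  \<open>(x + 1) * sconj (x + 1)\<close> shows that \<open>x + sconj x\<close> is real, so every \<open>x\<close> is a root of a
  monic real quadratic polynomial and the field has degree at most 2 over the reals.
\<close>

class real_or_complex = real_normed_field +
  fixes sconj :: "'a \<Rightarrow> 'a"
  assumes sconj_add: "sconj (x + y) = sconj x + sconj y"
    and sconj_mult: "sconj (x * y) = sconj x * sconj y"
    and mult_sconj: "x * sconj x = (norm x)\<^sup>2 *\<^sub>R 1"

instantiation real :: real_or_complex
begin
definition sconj_real :: "real \<Rightarrow> real" where "sconj_real x = x"
instance by standard (simp_all add: sconj_real_def power2_eq_square)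
end

instantiation complex :: real_or_complex
begin
definition sconj_complex :: "complex \<Rightarrow> complex" where "sconj_complex = cnj"
instance by standard (simp_all add: sconj_complex_def complex_mult_cnj cmod_power2 scaleR_conv_of_real)
end

text \<open>
  The whole type \<open>'a\<close> is the Hilbert space, \<open>smul\<close> its scalar multiplication and \<open>ip\<close> its inner
  product, linear in the first argument. Completeness is part of the class \<open>banach\<close>, whose norm
  is required to be the one induced by \<open>ip\<close>.
\<close>

locale hilbert_space = vector_space smul
  for smul :: "'k::real_or_complex \<Rightarrow> 'a::banach \<Rightarrow> 'a" +
  fixes ip :: "'a \<Rightarrow> 'a \<Rightarrow> 'k"
  assumes smul_of_real: "smul (of_real r) x = r *\<^sub>R x"
    and ip_add_left: "ip (x + y) z = ip x z + ip y z"
    and ip_smul_left: "ip (smul c x) y = c * ip x y"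
    and ip_commute: "ip y x = sconj (ip x y)"
    and ip_self: "ip x x = of_real ((norm x)\<^sup>2)"

lemma hilbert_space_real_inner:
  "hilbert_space ((*\<^sub>R) :: real \<Rightarrow> 'a::{real_inner,banach} \<Rightarrow> 'a) (\<bullet>)"
  by unfold_locales
     (simp_all add: sconj_real_def inner_commute inner_add_left dot_square_norm algebra_simps)

lemma hilbert_space_complex:
  "hilbert_space ((*) :: complex \<Rightarrow> complex \<Rightarrow> complex) (\<lambda>x y. x * cnj y)"
  by unfold_locales
     (simp_all add: sconj_complex_def scaleR_conv_of_real algebra_simps complex_mult_cnj cmod_power2)

text \<open>Summability is required explicitly, since \<open>infsum\<close> is \<open>0\<close> on families that are not summable.\<close>

definition is_frame :: "('a::banach \<Rightarrow> 'a \<Rightarrow> 'k::real_or_complex) \<Rightarrow> 'i set \<Rightarrow> ('i \<Rightarrow> 'a) \<Rightarrow> bool"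
  where "is_frame ip I f \<longleftrightarrow> countable I \<and>
    (\<exists>A>0. \<exists>B>0. \<forall>x.
       (\<lambda>i. (norm (ip x (f i)))\<^sup>2) summable_on I \<and>
       A * (norm x)\<^sup>2 \<le> (\<Sum>\<^sub>\<infinity>i\<in>I. (norm (ip x (f i)))\<^sup>2) \<and>
       (\<Sum>\<^sub>\<infinity>i\<in>I. (norm (ip x (f i)))\<^sup>2) \<le> B * (norm x)\<^sup>2)"

definition square_summable :: "(nat \<Rightarrow> 'k::real_or_complex) \<Rightarrow> bool"
  where "square_summable a \<longleftrightarrow> summable (\<lambda>i. (norm (a i))\<^sup>2)"

text \<open>\<open>summable\<close> is convergence of the partial sums in the given order, in norm.\<close>

definition besselian_frame ::
    "('k::real_or_complex \<Rightarrow> 'a::banach \<Rightarrow> 'a) \<Rightarrow> ('a \<Rightarrow> 'a \<Rightarrow> 'k) \<Rightarrow> (nat \<Rightarrow> 'a) \<Rightarrow> bool"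
  where "besselian_frame smul ip f \<longleftrightarrow> is_frame ip UNIV f \<and>
    (\<forall>a. summable (\<lambda>i. smul (a i) (f i)) \<longrightarrow> square_summable a)"

definition robust_to_1_erasure :: "('a::banach \<Rightarrow> 'a \<Rightarrow> 'k::real_or_complex) \<Rightarrow> (nat \<Rightarrow> 'a) \<Rightarrow> bool"
  where "robust_to_1_erasure ip f \<longleftrightarrow> is_frame ip UNIV f \<and> (\<forall>m. is_frame ip (UNIV - {m}) f)"

end

theory Submission
  imports Defs "HOL-Complex_Analysis.Complex_Analysis"
begin

text \<open>Let S be the frame operator and T a = sum a_i f_i the synthesis map on ell^2. Both
  directions concern the kernel of T: the frame survives the loss of f_m exactly when some kernel
  element has a nonzero m-th coordinate.

  If T a = 0 and a_m is nonzero, pairing with x expresses <f_m, x> through the other <f_i, x>.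
  Cauchy-Schwarz then bounds |<x, f_m>|^2 by a constant times the sum of the other terms, so the
  lower bound survives (\<open>annihilating_coefficients_imp_frame\<close>).

  Conversely, S is bounded and coercive, hence onto (\<open>coercive_surj\<close>,
  \<open>frame_op_surj\<close>). With S x_m = f_m, the sequence e_m - (<x_m, f_i>)_i lies in the
  kernel of T; it is the projection of e_m onto it. Robustness makes its m-th coordinate nonzero.
  One kernel element must avoid zeros at all coordinates at once, so these sequences are combined
  with weights t^m. The real part of each coordinate is then a power series in t with bounded
  coefficients, not all zero, and has only countably many zeros in the unit interval
  (\<open>countable_zeros_bounded_power_series\<close>). Some t in (0, 1) therefore suits every
  coordinate (\<open>robust_imp_annihilating_coefficients\<close>).\<close>

section \<open>Scalars\<close>

lemma of_real_norm_power2: "x * sconj x = of_real ((norm x)\<^sup>2)"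
  for x :: "'k::real_or_complex"
  by (simp add: mult_sconj of_real_def)

lemma sconj_of_real [simp]: "sconj (of_real r :: 'k::real_or_complex) = of_real r"
proof (cases "r = 0")
  case True
  have "sconj (0::'k) + sconj 0 = sconj 0"
    using sconj_add[of "0::'k" 0] by simp
  with True show ?thesis by simp
next
  case False
  have "of_real r * sconj (of_real r :: 'k) = of_real r * of_real r"
    by (simp add: of_real_norm_power2 power2_eq_square del: of_real_mult flip: of_real_mult)
  with False show ?thesis by simp
qed

lemma sconj_1 [simp]: "sconj (1 :: 'k::real_or_complex) = 1"
  using sconj_of_real[of 1, where 'k = 'k] by simp

lemma norm_sconj [simp]: "norm (sconj x) = norm x"
  for x :: "'k::real_or_complex"
proof (cases "x = 0")
  case True
  then show ?thesis using sconj_of_real[of 0, where 'k = 'k] by simp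
next
  case False
  have "norm x * norm (sconj x) = norm x * norm x"
    using arg_cong[OF of_real_norm_power2[of x], of norm]
    by (simp add: norm_mult power2_eq_square)
  with False show ?thesis by simp
qed

text \<open>The class provides no real part, so it is recovered by polarization from |z + 1|^2 =
  |z|^2 + 2 Re z + 1. Linearity is not visible in this form; it comes from
  \<open>of_real_re_part\<close>.\<close>

definition re_part :: "'k::real_or_complex \<Rightarrow> real"
  where "re_part z = ((norm (z + 1))\<^sup>2 - (norm z)\<^sup>2 - 1) / 2"

lemma of_real_re_part: "of_real (2 * re_part z) = z + sconj z"
  for z :: "'k::real_or_complex"
proof -
  have "of_real ((norm (z + 1))\<^sup>2) = of_real ((norm z)\<^sup>2) + z + sconj z + 1"
    unfolding of_real_norm_power2[symmetric] by (simp add: sconj_add algebra_simps)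
  then show ?thesis
    by (simp add: re_part_def)
qed

lemma re_part_eqI: "z + sconj z = of_real (2 * r) \<Longrightarrow> re_part z = r"
  for z :: "'k::real_or_complex"
  using of_real_eq_iff[of "2 * re_part z" "2 * r", where 'a = 'k] by (simp only: of_real_re_part) simp

lemma re_part_of_real [simp]: "re_part (of_real r :: 'k::real_or_complex) = r"
  by (rule re_part_eqI) simp

lemma abs_re_part_le: "\<bar>re_part z\<bar> \<le> norm z"
  for z :: "'k::real_or_complex"
proof -
  have "2 * \<bar>re_part z\<bar> = norm (z + sconj z)"
    unfolding of_real_re_part[symmetric] by (simp add: abs_mult)
  also have "\<dots> \<le> 2 * norm z"
    using norm_triangle_ineq[of z "sconj z"] by simp
  finally show ?thesis by simp
qed

lemma bounded_linear_re_part: "bounded_linear (re_part :: 'k::real_or_complex \<Rightarrow> real)"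
proof (rule bounded_linear_intro[where K = 1])
  show "re_part (x + y) = re_part x + re_part y" for x y :: 'k
    by (rule re_part_eqI)
      (use of_real_re_part[of x] of_real_re_part[of y] in \<open>simp add: sconj_add algebra_simps\<close>)
  show "re_part (r *\<^sub>R x) = r *\<^sub>R re_part x" for r and x :: 'k
  proof (rule re_part_eqI)
    have "r *\<^sub>R x + sconj (r *\<^sub>R x) = of_real r * (x + sconj x)"
      by (simp add: scaleR_conv_of_real sconj_mult algebra_simps)
    then show "r *\<^sub>R x + sconj (r *\<^sub>R x) = of_real (2 * (r *\<^sub>R re_part x))"
      unfolding of_real_re_part[symmetric] by simp
  qed
qed (simp add: abs_re_part_le)

lemmas re_part_add = bounded_linear.linear[OF bounded_linear_re_part, THEN linear_add]
lemmas re_part_diff = bounded_linear.linear[OF bounded_linear_re_part, THEN linear_diff]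
lemmas re_part_scaleR = bounded_linear.linear[OF bounded_linear_re_part, THEN linear_scale]

section \<open>Zeros of power series\<close>

text \<open>Bounded coefficients make the series holomorphic on the complex unit disc, where a
  function that is not identically zero has countably many zeros.\<close>

lemma countable_zeros_bounded_power_series:
  fixes c :: "nat \<Rightarrow> real"
  assumes bound: "\<And>n. \<bar>c n\<bar> \<le> C" and "c k \<noteq> 0"
  shows "countable {t. \<bar>t\<bar> < 1 \<and> (\<Sum>n. c n * t ^ n) = 0}"
proof -
  define F where "F = Abs_fps (\<lambda>n. complex_of_real (c n))"
  define Z where "Z = {z \<in> ball 0 1. eval_fps F z = 0}"
  have summ: "summable (\<lambda>n. c n * t ^ n)" if "\<bar>t\<bar> < 1" for t
  proof (rule summable_comparison_test')
    show "summable (\<lambda>n. C * \<bar>t\<bar> ^ n)"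
      using that by (intro summable_mult summable_geometric) simp
    show "norm (c n * t ^ n) \<le> C * \<bar>t\<bar> ^ n" for n
      using bound by (simp add: abs_mult power_abs mult_right_mono)
  qed
  have eval_F: "eval_fps F (of_real t) = of_real (\<Sum>n. c n * t ^ n)" if "\<bar>t\<bar> < 1" for t
    using bounded_linear.suminf[OF bounded_linear_of_real[where 'a = complex] summ[OF that]]
    by (simp add: eval_fps_def F_def)
  have "summable (\<lambda>n. fps_nth F n * of_real t ^ n)" if "0 < t" "t < 1" for t
    using bounded_linear.summable[OF bounded_linear_of_real[where 'a = complex] summ[of t]] that
    by (simp add: F_def)
  then have radius: "fps_conv_radius F \<ge> 1"
    unfolding fps_conv_radius_def by (intro conv_radius_geI_ex') auto
  have "F \<noteq> 0"
  proof
    assume "F = 0"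
    then have "fps_nth F k = 0" by simp
    with \<open>c k \<noteq> 0\<close> show False by (simp add: F_def)
  qed
  \<comment> \<open>The library result on zeros excludes constant functions. A constant here cannot
    be 0, since \<open>F\<close> is nonzero, so that case has no zeros at all.\<close>
  have "countable Z"
  proof (cases "eval_fps F constant_on ball 0 1")
    case True
    then obtain w where w: "\<And>z. z \<in> ball 0 1 \<Longrightarrow> eval_fps F z = w"
      by (auto simp: constant_on_def)
    have "w \<noteq> 0"
    proof
      assume "w = 0"
      have "eventually (\<lambda>z::complex. z \<in> ball 0 1) (nhds 0)"
        by (intro eventually_nhds_in_open) auto
      then have "eventually (\<lambda>z. eval_fps F z = eval_fps 0 z) (nhds 0)"
        by eventually_elim (simp add: w \<open>w = 0\<close>)
      moreover have "fps_conv_radius F > 0"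
        using radius by (rule less_le_trans[rotated]) simp
      ultimately have "F = 0"
        by (intro eval_fps_eqD) auto
      with \<open>F \<noteq> 0\<close> show False ..
    qed
    then have "Z = {}"
      using w by (auto simp: Z_def)
    then show ?thesis by simp
  next
    case False
    have "eval_fps F holomorphic_on ball 0 1"
    proof (rule holomorphic_on_eval_fps, rule subsetI)
      fix z :: complex
      assume "z \<in> ball 0 1"
      then have "ereal (norm z) < 1" by simp
      also note radius
      finally show "z \<in> eball 0 (fps_conv_radius F)" by simp
    qed
    moreover obtain K :: "nat \<Rightarrow> complex set"
      where "\<And>n. compact (K n)" "\<Union>(range K) = ball 0 1"
      by (rule open_Union_compact_subsets[OF open_ball[of "0::complex" 1]]) metis
    then have "fsigma (ball 0 1 :: complex set)"
      using fsigma.intros[of K] by (simp add: compact_imp_closed)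
    ultimately show ?thesis
      unfolding Z_def using False by (intro holomorphic_countable_zeros) auto
  qed
  moreover have "inj_on complex_of_real {t. \<bar>t\<bar> < 1 \<and> (\<Sum>n. c n * t ^ n) = 0}"
    by (simp add: inj_on_def)
  moreover have "complex_of_real ` {t. \<bar>t\<bar> < 1 \<and> (\<Sum>n. c n * t ^ n) = 0} \<subseteq> Z"
    by (auto simp: Z_def eval_F)
  ultimately show ?thesis
    using countable_subset countable_image_inj_on by blast
qed

section \<open>Inner products\<close>

context hilbert_space
begin

lemma ip_add_right: "ip x (y + z) = ip x y + ip x z"
  using ip_add_left[of y z x] by (simp add: ip_commute[of x] sconj_add)

lemma ip_smul_right: "ip x (smul c y) = sconj c * ip x y"
  using ip_smul_left[of c y x] by (simp add: ip_commute[of x] sconj_mult)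

lemma norm_ip_commute: "norm (ip x y) = norm (ip y x)"
  by (simp add: ip_commute[of x y])

lemma re_part_ip_commute: "re_part (ip x y) = re_part (ip y x)"
proof (rule re_part_eqI)
  have "sconj (ip x y) = ip y x" "ip x y = sconj (ip y x)"
    using ip_commute[of x y] ip_commute[of y x] by auto
  then show "ip x y + sconj (ip x y) = of_real (2 * re_part (ip y x))"
    by (simp only: of_real_re_part add.commute)
qed

lemma norm_ip_self: "norm (ip x x) = (norm x)\<^sup>2"
  by (simp only: ip_self norm_of_real abs_power2)

text \<open>The locale ties the norm to \<open>smul\<close> only for real scalars; for general ones
  homogeneity follows from sesquilinearity.\<close>

lemma norm_smul: "norm (smul c x) = norm c * norm x"
proof -
  have "of_real ((norm (smul c x))\<^sup>2) = c * sconj c * ip x x"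
    unfolding ip_self[symmetric] ip_smul_left ip_smul_right by (simp add: mult.assoc)
  also have "\<dots> = of_real ((norm c * norm x)\<^sup>2)"
    by (simp add: of_real_norm_power2 ip_self power_mult_distrib)
  finally show ?thesis
    by (simp only: of_real_eq_iff power2_eq_iff_nonneg norm_ge_zero mult_nonneg_nonneg)
qed

lemma norm_add_power2: "(norm (x + y))\<^sup>2 = (norm x)\<^sup>2 + 2 * re_part (ip x y) + (norm y)\<^sup>2"
proof -
  have "(norm (x + y))\<^sup>2 = re_part (ip (x + y) (x + y))"
    by (simp only: ip_self re_part_of_real)
  also have "\<dots> = re_part (ip x x) + re_part (ip x y) + re_part (ip y x) + re_part (ip y y)"
    by (simp add: ip_add_left ip_add_right re_part_add)
  also have "re_part (ip y x) = re_part (ip x y)"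
    by (rule re_part_ip_commute)
  finally show ?thesis by (simp only: ip_self re_part_of_real)
qed

text \<open>Since the norm already satisfies the triangle inequality, squaring it yields
  Cauchy-Schwarz for real parts.\<close>

lemma re_part_ip_le: "re_part (ip x y) \<le> norm x * norm y"
proof -
  have "(norm (x + y))\<^sup>2 \<le> (norm x + norm y)\<^sup>2"
    by (intro power_mono norm_triangle_ineq) simp
  then show ?thesis
    by (simp add: norm_add_power2 power2_sum)
qed

lemma norm_ip_le: "norm (ip x y) \<le> norm x * norm y"
proof (cases "ip x y = 0")
  case False
  \<comment> \<open>Multiplying x by the conjugate of <x, y> makes the inner product real, which
    reduces the claim to \<open>re_part_ip_le\<close>.\<close>
  have "(norm (ip x y))\<^sup>2 = re_part (ip (smul (sconj (ip x y)) x) y)"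
    using of_real_norm_power2[of "ip x y"] by (simp only: ip_smul_left mult.commute re_part_of_real)
  also have "\<dots> \<le> norm (smul (sconj (ip x y)) x) * norm y"
    by (rule re_part_ip_le)
  finally have "norm (ip x y) * norm (ip x y) \<le> norm (ip x y) * (norm x * norm y)"
    by (simp add: norm_smul power2_eq_square mult_ac)
  with False show ?thesis
    by simp
qed simp

lemma scaleR_conv_smul: "r *\<^sub>R x = smul (of_real r) x"
  by (simp add: smul_of_real)

lemma bounded_linear_ip_left: "bounded_linear (\<lambda>x. ip x y)"
  by (rule bounded_linear_intro[where K = "norm y"])
    (simp_all add: ip_add_left scaleR_conv_smul ip_smul_left scaleR_conv_of_real norm_ip_le
      del: smul_of_real)

lemmas ip_sum_left = bounded_linear.linear[OF bounded_linear_ip_left, THEN linear_sum]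
lemmas ip_scaleR_left = bounded_linear.linear[OF bounded_linear_ip_left, THEN linear_scale]
lemmas ip_zero_left = bounded_linear.linear[OF bounded_linear_ip_left, THEN linear_0]

lemma ip_sum_smul_left: "ip (\<Sum>i\<in>F. smul (a i) (g i)) y = (\<Sum>i\<in>F. a i * ip (g i) y)"
  by (simp add: ip_sum_left ip_smul_left)

text \<open>For small \<open>t > 0\<close> the map \<open>x \<mapsto> x - t (S x - y)\<close> is a contraction.\<close>

lemma coercive_surj:
  assumes S: "bounded_linear S" and "A > 0"
    and coercive: "\<And>x. A * (norm x)\<^sup>2 \<le> re_part (ip (S x) x)"
  shows "\<exists>x. S x = y"
proof -
  interpret S: bounded_linear S by fact
  obtain M where M: "M > 0" "\<And>x. norm (S x) \<le> norm x * M"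
    using S.pos_bounded by blast
  \<comment> \<open>\<open>K\<close> bounds S and is at least \<open>A\<close>, so that
    \<open>c\<close> is nonnegative. \<open>t\<close> minimizes 1 - 2tA + t^2 K^2, and
    \<open>c\<close> is the minimum.\<close>
  define K t c where "K = M + A" and "t = A / K\<^sup>2" and "c = 1 - (A / K)\<^sup>2"
  have K: "K > 0" "A \<le> K" using M(1) \<open>A > 0\<close> by (auto simp: K_def)
  then have t: "t > 0" and c: "0 \<le> c" "c < 1"
    using \<open>A > 0\<close> by (auto simp: t_def c_def divide_le_eq power_le_one)
  have contr: "(norm (x - t *\<^sub>R S x))\<^sup>2 \<le> c * (norm x)\<^sup>2" for x
  proof -
    have "norm (S x) \<le> K * norm x"
      using M(2)[of x] mult_nonneg_nonneg[OF less_imp_le[OF \<open>A > 0\<close>] norm_ge_zero, of x]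
      unfolding K_def distrib_right mult.commute[of "norm x"] by linarith
    then have "(norm (S x))\<^sup>2 \<le> K\<^sup>2 * (norm x)\<^sup>2"
      using power_mono[of "norm (S x)" "K * norm x" 2] by (simp add: power_mult_distrib)
    then have b: "t\<^sup>2 * (norm (S x))\<^sup>2 \<le> t\<^sup>2 * (K\<^sup>2 * (norm x)\<^sup>2)"
      by (intro mult_left_mono) auto
    have "re_part (ip x (- t *\<^sub>R S x)) = - t * re_part (ip (S x) x)"
      by (subst re_part_ip_commute) (simp only: ip_scaleR_left re_part_scaleR real_scaleR_def)
    then have "(norm (x - t *\<^sub>R S x))\<^sup>2
        = (norm x)\<^sup>2 - 2 * (t * re_part (ip (S x) x)) + t\<^sup>2 * (norm (S x))\<^sup>2"
      using norm_add_power2[of x "- t *\<^sub>R S x"] by (simp add: power_mult_distrib)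
    also have "\<dots> \<le> (norm x)\<^sup>2 - 2 * (t * (A * (norm x)\<^sup>2)) + t\<^sup>2 * (K\<^sup>2 * (norm x)\<^sup>2)"
      using mult_left_mono[OF coercive[of x] less_imp_le[OF t]] b by linarith
    also have "\<dots> = (1 - 2 * (t * A) + t\<^sup>2 * K\<^sup>2) * (norm x)\<^sup>2"
      by (simp add: algebra_simps)
    also have "1 - 2 * (t * A) + t\<^sup>2 * K\<^sup>2 = c"
      using K by (simp add: t_def c_def power2_eq_square field_simps)
    finally show ?thesis .
  qed
  have "\<exists>!x. x - t *\<^sub>R (S x - y) = x"
  proof (rule banach_fix_type[where c = "sqrt c"]; (intro allI)?)
    show "sqrt c < 1" "0 \<le> sqrt c" using c by auto
    fix x z :: 'a
    have "dist (x - t *\<^sub>R (S x - y)) (z - t *\<^sub>R (S z - y)) = norm ((x - z) - t *\<^sub>R S (x - z))"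
      by (simp add: dist_norm S.diff algebra_simps)
    also have "\<dots> \<le> sqrt (c * (norm (x - z))\<^sup>2)"
      using contr by (rule real_le_rsqrt)
    finally show "dist (x - t *\<^sub>R (S x - y)) (z - t *\<^sub>R (S z - y)) \<le> sqrt c * dist x z"
      by (simp add: real_sqrt_mult dist_norm)
  qed
  then show ?thesis
    using t by auto
qed

end

section \<open>The frame operator\<close>

locale hilbert_frame = hilbert_space smul ip
  for smul :: "'k::real_or_complex \<Rightarrow> 'a::banach \<Rightarrow> 'a" and ip +
  fixes f :: "nat \<Rightarrow> 'a" and A B :: real
  assumes A_pos: "A > 0" and B_pos: "B > 0"
    and summable_analysis: "summable (\<lambda>i. (norm (ip x (f i)))\<^sup>2)"
    and lower_bound: "A * (norm x)\<^sup>2 \<le> (\<Sum>i. (norm (ip x (f i)))\<^sup>2)"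
    and upper_bound: "(\<Sum>i. (norm (ip x (f i)))\<^sup>2) \<le> B * (norm x)\<^sup>2"
begin

text \<open>Synthesis is adjoint to analysis: with v the sum, |v|^2 = sum a_i <f_i, v>. Apply
  Cauchy-Schwarz and the upper frame bound at v itself, then cancel |v|^2.\<close>

lemma norm_sum_smul_le:
  assumes "finite F"
  shows "(norm (\<Sum>i\<in>F. smul (a i) (f i)))\<^sup>2 \<le> B * (\<Sum>i\<in>F. (norm (a i))\<^sup>2)"
proof -
  define v where "v = (\<Sum>i\<in>F. smul (a i) (f i))"
  define P where "P = (\<Sum>i\<in>F. (norm (a i))\<^sup>2)"
  have "P \<ge> 0" by (simp add: P_def sum_nonneg)
  have "(norm v)\<^sup>2 = norm (ip v v)"
    by (simp add: norm_ip_self)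
  also have "\<dots> = norm (\<Sum>i\<in>F. a i * ip (f i) v)"
    by (subst (1) v_def) (simp only: ip_sum_smul_left)
  also have "\<dots> \<le> (\<Sum>i\<in>F. norm (a i) * norm (ip v (f i)))"
    by (rule sum_norm_le) (simp add: norm_mult norm_ip_commute[of v])
  finally have "((norm v)\<^sup>2)\<^sup>2 \<le> (\<Sum>i\<in>F. norm (a i) * norm (ip v (f i)))\<^sup>2"
    by (rule power_mono) simp
  also have "\<dots> \<le> P * (\<Sum>i\<in>F. (norm (ip v (f i)))\<^sup>2)"
    unfolding P_def by (rule Cauchy_Schwarz_ineq_sum)
  also have "\<dots> \<le> P * (\<Sum>i. (norm (ip v (f i)))\<^sup>2)"
    using \<open>finite F\<close> \<open>P \<ge> 0\<close> by (intro mult_left_mono sum_le_suminf summable_analysis) auto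
  also have "\<dots> \<le> P * (B * (norm v)\<^sup>2)"
    using \<open>P \<ge> 0\<close> by (intro mult_left_mono upper_bound)
  finally have "(norm v)\<^sup>2 * (norm v)\<^sup>2 \<le> (B * P) * (norm v)\<^sup>2"
    by (simp add: power2_eq_square mult_ac)
  then have "(norm v)\<^sup>2 \<le> B * P"
    using \<open>P \<ge> 0\<close> B_pos mult_right_le_imp_le[of "(norm v)\<^sup>2" "(norm v)\<^sup>2" "B * P"]
    by (cases "v = 0") simp_all
  then show ?thesis
    by (simp add: v_def P_def)
qed

lemma summable_synthesis:
  assumes "square_summable a"
  shows "summable (\<lambda>i. smul (a i) (f i))"
  unfolding summable_Cauchy
proof (intro allI impI)
  fix e :: real assume "e > 0"
  then have "e\<^sup>2 / B > 0" using B_pos by simp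
  then obtain N where N: "\<And>m n. m \<ge> N \<Longrightarrow> norm (\<Sum>i\<in>{m..<n}. (norm (a i))\<^sup>2) < e\<^sup>2 / B"
    using assms unfolding square_summable_def summable_Cauchy by blast
  have "norm (\<Sum>i\<in>{m..<n}. smul (a i) (f i)) < e" if "m \<ge> N" for m n
  proof -
    have "(norm (\<Sum>i\<in>{m..<n}. smul (a i) (f i)))\<^sup>2 \<le> B * (\<Sum>i\<in>{m..<n}. (norm (a i))\<^sup>2)"
      by (rule norm_sum_smul_le) simp
    also have "\<dots> < e\<^sup>2"
      using N[OF that, of n] B_pos by (simp add: sum_nonneg pos_less_divide_eq mult.commute)
    finally show ?thesis
      using \<open>e > 0\<close> by (intro power_less_imp_less_base[of _ 2 e]) simp_all
  qed
  then show "\<exists>N. \<forall>m\<ge>N. \<forall>n. norm (\<Sum>i\<in>{m..<n}. smul (a i) (f i)) < e"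
    by (intro exI[of _ N] allI impI)
qed

lemma summable_on_analysis: "(\<lambda>i. (norm (ip x (f i)))\<^sup>2) summable_on UNIV"
  by (rule norm_summable_imp_summable_on) (simp add: summable_analysis)

lemma suminf_analysis_split:
  "(\<Sum>i. (norm (ip x (f i)))\<^sup>2)
    = (norm (ip x (f m)))\<^sup>2 + (\<Sum>\<^sub>\<infinity>i\<in>UNIV - {m}. (norm (ip x (f i)))\<^sup>2)"
proof -
  have "(\<Sum>i. (norm (ip x (f i)))\<^sup>2) = (\<Sum>\<^sub>\<infinity>i. (norm (ip x (f i)))\<^sup>2)"
    by (intro sums_unique[symmetric] has_sum_imp_sums has_sum_infsum summable_on_analysis)
  also have "UNIV = insert m (UNIV - {m})" by auto
  also have "(\<Sum>\<^sub>\<infinity>i\<in>insert m (UNIV - {m}). (norm (ip x (f i)))\<^sup>2)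
      = (norm (ip x (f m)))\<^sup>2 + (\<Sum>\<^sub>\<infinity>i\<in>UNIV - {m}. (norm (ip x (f i)))\<^sup>2)"
    by (intro infsum_insert summable_on_subset_banach[OF summable_on_analysis]) auto
  finally show ?thesis .
qed

section \<open>Boundedness and invertibility of the frame operator\<close>

definition frame_op :: "'a \<Rightarrow> 'a"
  where "frame_op x = (\<Sum>i. smul (ip x (f i)) (f i))"

lemma frame_op_sums: "(\<lambda>i. smul (ip x (f i)) (f i)) sums frame_op x"
  unfolding frame_op_def
  by (intro summable_sums summable_synthesis) (simp add: square_summable_def summable_analysis)

lemma norm_frame_op_le: "norm (frame_op x) \<le> B * norm x"
proof -
  have "(norm (\<Sum>i<n. smul (ip x (f i)) (f i)))\<^sup>2 \<le> (B * norm x)\<^sup>2" for n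
  proof -
    have "(norm (\<Sum>i<n. smul (ip x (f i)) (f i)))\<^sup>2 \<le> B * (\<Sum>i<n. (norm (ip x (f i)))\<^sup>2)"
      by (rule norm_sum_smul_le) simp
    also have "\<dots> \<le> B * (\<Sum>i. (norm (ip x (f i)))\<^sup>2)"
      using B_pos by (intro mult_left_mono sum_le_suminf summable_analysis) auto
    also have "\<dots> \<le> B * (B * (norm x)\<^sup>2)"
      using B_pos by (intro mult_left_mono upper_bound) auto
    finally show ?thesis
      by (simp add: power_mult_distrib power2_eq_square mult_ac)
  qed
  then have "norm (\<Sum>i<n. smul (ip x (f i)) (f i)) \<le> B * norm x" for n
    by (rule power2_le_imp_le) (use B_pos in simp)
  then show ?thesis
    by (intro LIMSEQ_le_const2[OF tendsto_norm[OF frame_op_sums[of x, unfolded sums_def]]] exI allI impI)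
qed

lemma bounded_linear_frame_op: "bounded_linear frame_op"
proof (rule bounded_linear_intro[where K = B])
  show "frame_op (x + y) = frame_op x + frame_op y" for x y
    using frame_op_sums[of "x + y"] sums_add[OF frame_op_sums[of x] frame_op_sums[of y]]
    unfolding ip_add_left scale_left_distrib by (rule sums_unique2)
  show "frame_op (r *\<^sub>R x) = r *\<^sub>R frame_op x" for r x
    using frame_op_sums[of "r *\<^sub>R x"] sums_scaleR_right[OF frame_op_sums[of x], of r]
    unfolding scaleR_conv_smul ip_smul_left scale_scale by (rule sums_unique2)
  show "norm (frame_op x) \<le> norm x * B" for x
    using norm_frame_op_le[of x] by (simp add: mult.commute)
qed

lemma re_part_ip_frame_op: "re_part (ip (frame_op x) x) = (\<Sum>i. (norm (ip x (f i)))\<^sup>2)"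
proof (rule sums_unique)
  have "ip x (f i) * ip (f i) x = of_real ((norm (ip x (f i)))\<^sup>2)" for i
    by (simp only: ip_commute[of "f i" x] of_real_norm_power2)
  then show "(\<lambda>i. (norm (ip x (f i)))\<^sup>2) sums re_part (ip (frame_op x) x)"
    using bounded_linear.sums[OF bounded_linear_re_part
        bounded_linear.sums[OF bounded_linear_ip_left[of x] frame_op_sums[of x]]]
    by (simp only: ip_smul_left re_part_of_real)
qed

lemma frame_op_coercive: "A * (norm x)\<^sup>2 \<le> re_part (ip (frame_op x) x)"
  unfolding re_part_ip_frame_op by (rule lower_bound)

lemma frame_op_surj: "\<exists>x. frame_op x = y"
  by (rule coercive_surj[OF bounded_linear_frame_op A_pos frame_op_coercive])

lemma norm_le_frame_op: "norm x \<le> norm (frame_op x) / A"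
proof -
  \<comment> \<open>Coercivity and Cauchy-Schwarz combine into a lower bound for the operator, which
    later bounds all preimages of the f_m uniformly.\<close>
  have "A * (norm x)\<^sup>2 \<le> norm (frame_op x) * norm x"
    using frame_op_coercive[of x] re_part_ip_le[of "frame_op x" x] by linarith
  then have "norm x * (norm x * A) \<le> norm x * norm (frame_op x)"
    by (simp add: power2_eq_square mult_ac)
  then show ?thesis
    using A_pos by (cases "x = 0") (auto simp: pos_le_divide_eq)
qed

lemma norm_frame_le: "norm (f m) \<le> sqrt B"
proof -
  have "(norm (ip (f m) (f m)))\<^sup>2 \<le> (\<Sum>i. (norm (ip (f m) (f i)))\<^sup>2)"
    using sum_le_suminf[OF summable_analysis[of "f m"], of "{m}"] by simp
  then have "((norm (f m))\<^sup>2)\<^sup>2 \<le> B * (norm (f m))\<^sup>2"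
    using upper_bound[of "f m"] by (simp add: norm_ip_self)
  then have "(norm (f m))\<^sup>2 * (norm (f m))\<^sup>2 \<le> B * (norm (f m))\<^sup>2"
    by (simp add: power2_eq_square)
  then have "(norm (f m))\<^sup>2 \<le> B"
    using B_pos mult_right_le_imp_le[of "(norm (f m))\<^sup>2" "(norm (f m))\<^sup>2" B]
    by (cases "f m = 0") simp_all
  then show ?thesis by (rule real_le_rsqrt)
qed

section \<open>The two implications\<close>

text \<open>With \<open>x\<^sub>m\<close> the preimage of \<open>f\<^sub>m\<close> under the frame operator and \<open>v = \<Sum>\<^sub>m t^m x\<^sub>m\<close>, the
  coefficients \<open>a\<^sub>i = t^i - \<langle>v, f\<^sub>i\<rangle>\<close> annihilate the frame for every \<open>t\<close> in \<open>(0, 1)\<close>. The real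
  part of \<open>a\<^sub>i\<close> is a power series in \<open>t\<close> whose \<open>i\<close>-th coefficient is nonzero since the frame
  without \<open>f\<^sub>i\<close> still has a lower bound, so only countably many \<open>t\<close> are bad.\<close>

lemma robust_imp_annihilating_coefficients:
  assumes robust: "\<And>m. is_frame ip (UNIV - {m}) f"
  shows "\<exists>a. square_summable a \<and> (\<forall>i. a i \<noteq> 0) \<and> (\<lambda>i. smul (a i) (f i)) sums 0"
proof -
  obtain X where X: "\<And>m. frame_op (X m) = f m"
    using choice[of "\<lambda>m x. frame_op x = f m"] frame_op_surj by auto
  define D where "D = sqrt B / A"
  have norm_X: "norm (X m) \<le> D" for m
    using norm_le_frame_op[of "X m"] divide_right_mono[OF norm_frame_le[of m], of A] A_pos
    by (simp add: X D_def)
  have "D \<ge> 0" using A_pos B_pos by (simp add: D_def)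
  \<comment> \<open>If the real part were 1, then sum_j |<x_i, f_j>|^2 = Re <S x_i, x_i> = Re <f_i,
    x_i> = 1 would be exhausted by the term j = i. The lower bound without f_i would force x_i = 0,
    contradicting <x_i, f_i> having real part 1.\<close>
  have diag: "re_part (ip (X i) (f i)) \<noteq> 1" for i
  proof
    assume re1: "re_part (ip (X i) (f i)) = 1"
    from robust[of i] obtain A' where "A' > 0" and
      A': "A' * (norm (X i))\<^sup>2 \<le> (\<Sum>\<^sub>\<infinity>j\<in>UNIV - {i}. (norm (ip (X i) (f j)))\<^sup>2)"
      unfolding is_frame_def by blast
    have "(norm (ip (X i) (f i)))\<^sup>2 \<ge> 1"
      using abs_re_part_le[of "ip (X i) (f i)"] re1 by simp
    moreover have "(\<Sum>j. (norm (ip (X i) (f j)))\<^sup>2) = 1"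
      using re_part_ip_frame_op[of "X i"] re1 by (simp add: X re_part_ip_commute)
    ultimately have "A' * (norm (X i))\<^sup>2 \<le> 0"
      using A' suminf_analysis_split[of "X i" i] by linarith
    then have "X i = 0"
      using \<open>A' > 0\<close> by (simp add: mult_le_0_iff)
    with re1 show False
      using re_part_of_real[of 0, where 'k = 'k] by (simp add: ip_zero_left)
  qed
  \<comment> \<open>The real part of the i-th coordinate of e_m - (<x_m, f_j>)_j;
    \<open>diag\<close> is the statement that \<open>c i i\<close> is nonzero.\<close>
  define c where "c i m = (if m = i then 1 else 0) - re_part (ip (X m) (f i))" for i m
  have c_bound: "\<bar>c i m\<bar> \<le> 1 + D * sqrt B" for i m
  proof -
    have "\<bar>re_part (ip (X m) (f i))\<bar> \<le> norm (X m) * norm (f i)"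
      by (rule order_trans[OF abs_re_part_le norm_ip_le])
    also have "\<dots> \<le> D * sqrt B"
      using \<open>D \<ge> 0\<close> by (intro mult_mono norm_X norm_frame_le) auto
    finally show ?thesis by (auto simp: c_def)
  qed
  define U where "U = (\<Union>i. {t. \<bar>t\<bar> < 1 \<and> (\<Sum>m. c i m * t ^ m) = 0})"
  have "countable U"
    unfolding U_def
  proof (intro countable_UN countable_zeros_bounded_power_series)
    show "c i i \<noteq> 0" for i using diag[of i] by (simp add: c_def)
  qed (auto intro: c_bound)
  then have "\<not> {0<..<1} \<subseteq> U"
    using countable_subset uncountable_open_interval[of "0::real" 1] zero_less_one by metis
  then obtain t where "t \<in> {0<..<1}" "t \<notin> U" by blast
  then have t: "0 < t" "t < 1" and t0: "\<And>i. (\<Sum>m. c i m * t ^ m) \<noteq> 0"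
    by (simp_all add: U_def)
  define v where "v = (\<Sum>m. t ^ m *\<^sub>R X m)"
  have "summable (\<lambda>m. t ^ m *\<^sub>R X m)"
  proof (rule summable_comparison_test')
    show "summable (\<lambda>m. t ^ m * D)"
      using t by (intro summable_mult2 summable_geometric) simp
    show "norm (t ^ m *\<^sub>R X m) \<le> t ^ m * D" for m
      using t norm_X[of m] by (simp add: mult_left_mono)
  qed
  then have v: "(\<lambda>m. t ^ m *\<^sub>R X m) sums v"
    unfolding v_def by (rule summable_sums)
  define a where "a i = of_real (t ^ i) - ip v (f i)" for i
  have "(\<lambda>m. t ^ m *\<^sub>R f m) sums frame_op v"
    using bounded_linear.sums[OF bounded_linear_frame_op v]
    by (simp add: bounded_linear.linear[OF bounded_linear_frame_op, THEN linear_scale] X)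
  \<comment> \<open>S v is expanded twice: as sum t^m f_m by continuity, and as sum <v, f_i> f_i by
    definition. The difference has the terms a_i f_i.\<close>
  from sums_diff[OF this frame_op_sums[of v]]
  have "(\<lambda>i. smul (a i) (f i)) sums 0"
    by (simp add: a_def scale_left_diff_distrib scaleR_conv_smul del: smul_of_real of_real_power)
  moreover have "a i \<noteq> 0" for i
  proof
    have "(\<lambda>m. t ^ m * re_part (ip (X m) (f i))) sums re_part (ip v (f i))"
      using bounded_linear.sums[OF bounded_linear_re_part
          bounded_linear.sums[OF bounded_linear_ip_left v]]
      by (simp add: ip_scaleR_left re_part_scaleR)
    from sums_diff[OF sums_single[of i "\<lambda>m. t ^ m"] this]
    have "(\<lambda>m. c i m * t ^ m) sums (t ^ i - re_part (ip v (f i)))"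
      by (rule back_subst[where P = "\<lambda>s. s sums _"]) (auto simp: c_def algebra_simps)
    then have "(\<Sum>m. c i m * t ^ m) = t ^ i - re_part (ip v (f i))"
      by (rule sums_unique[symmetric])
    also have "\<dots> = re_part (a i)"
      by (simp add: a_def re_part_diff del: of_real_power)
    finally have "re_part (a i) \<noteq> 0" using t0[of i] by simp
    moreover assume "a i = 0"
    ultimately show False
      using re_part_of_real[of 0, where 'k = 'k] by simp
  qed
  moreover have "square_summable a"
    unfolding square_summable_def
  proof (rule summable_comparison_test')
    show "summable (\<lambda>i. 2 * (t\<^sup>2) ^ i + 2 * (norm (ip v (f i)))\<^sup>2)"
      using t
      by (intro summable_add summable_mult summable_geometric summable_analysis)
        (simp add: power_less_one_iff)
    show "norm ((norm (a i))\<^sup>2) \<le> 2 * (t\<^sup>2) ^ i + 2 * (norm (ip v (f i)))\<^sup>2" for i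
    proof -
      have "norm (a i) \<le> t ^ i + norm (ip v (f i))"
        unfolding a_def using norm_triangle_ineq4[of "of_real (t ^ i)" "ip v (f i)"] t
        by (simp add: norm_power)
      then have "(norm (a i))\<^sup>2 \<le> (t ^ i + norm (ip v (f i)))\<^sup>2"
        by (rule power_mono) simp
      also have "\<dots> \<le> 2 * (t ^ i)\<^sup>2 + 2 * (norm (ip v (f i)))\<^sup>2"
        using sum_squares_bound[of "t ^ i" "norm (ip v (f i))"] by (simp add: power2_sum)
      finally show ?thesis
        by (simp add: power_mult[symmetric] mult.commute)
    qed
  qed
  ultimately show ?thesis by blast
qed

text \<open>Solving \<open>\<Sum>\<^sub>i a\<^sub>i f\<^sub>i = 0\<close> for \<open>f\<^sub>m\<close> bounds \<open>\<bar>\<langle>x, f\<^sub>m\<rangle>\<bar>\<close> by the remaining coefficients.\<close>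

lemma annihilating_coefficients_imp_frame:
  assumes a: "square_summable a" and "a m \<noteq> 0" and sums: "(\<lambda>i. smul (a i) (f i)) sums 0"
  shows "is_frame ip (UNIV - {m}) f"
proof -
  define P where "P = (\<Sum>i. (norm (a i))\<^sup>2)"
  define Q where "Q x = (\<Sum>\<^sub>\<infinity>i\<in>UNIV - {m}. (norm (ip x (f i)))\<^sup>2)" for x
  have "P \<ge> 0"
    using a by (auto simp: P_def square_summable_def intro: suminf_nonneg)
  have Q_nonneg: "Q x \<ge> 0" for x
    unfolding Q_def by (rule infsum_nonneg) simp
  have split: "(\<Sum>i. (norm (ip x (f i)))\<^sup>2) = (norm (ip x (f m)))\<^sup>2 + Q x" for x
    unfolding Q_def by (rule suminf_analysis_split)
  have summ: "(\<lambda>i. (norm (ip x (f i)))\<^sup>2) summable_on (UNIV - {m})" for x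
    by (rule summable_on_subset_banach[OF summable_on_analysis]) auto
  have coeff: "(norm (a m))\<^sup>2 * (norm (ip x (f m)))\<^sup>2 \<le> P * Q x" for x
  proof -
    \<comment> \<open>The pairing is done on partial sums: the defect <s N, x> is at most |s N| |x|,
      which tends to 0. \<open>N > m\<close> ensures that the term \<open>m\<close> is
      present.\<close>
    define s where "s N = (\<Sum>i<N. smul (a i) (f i))" for N
    have "norm (a m) * norm (ip x (f m)) \<le> norm (s N) * norm x + sqrt (P * Q x)" if "N > m" for N
    proof -
      define F where "F = {..<N} - {m}"
      have F: "finite F" "F \<subseteq> UNIV - {m}" by (auto simp: F_def)
      define r where "r = (\<Sum>i\<in>F. a i * ip (f i) x)"
      have "norm r \<le> (\<Sum>i\<in>F. norm (a i) * norm (ip x (f i)))"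
        unfolding r_def by (rule sum_norm_le) (simp add: norm_mult norm_ip_commute[of x])
      then have "(norm r)\<^sup>2 \<le> (\<Sum>i\<in>F. norm (a i) * norm (ip x (f i)))\<^sup>2"
        by (rule power_mono) simp
      also have "\<dots> \<le> (\<Sum>i\<in>F. (norm (a i))\<^sup>2) * (\<Sum>i\<in>F. (norm (ip x (f i)))\<^sup>2)"
        by (rule Cauchy_Schwarz_ineq_sum)
      also have "\<dots> \<le> P * Q x"
        unfolding P_def Q_def using a F
        by (intro mult_mono sum_le_suminf finite_sum_le_infsum summ)
          (auto simp: square_summable_def intro: suminf_nonneg sum_nonneg)
      finally have r: "norm r \<le> sqrt (P * Q x)" by (rule real_le_rsqrt)
      have "ip (s N) x = a m * ip (f m) x + r"
        using that unfolding s_def F_def r_def ip_sum_smul_left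
        by (intro sum.remove) auto
      then have "norm (a m * ip (f m) x) = norm (ip (s N) x - r)" by simp
      also have "\<dots> \<le> norm (s N) * norm x + sqrt (P * Q x)"
        using norm_triangle_ineq4[of "ip (s N) x" r] norm_ip_le[of "s N" x] r by linarith
      finally show ?thesis by (simp add: norm_mult norm_ip_commute[of x])
    qed
    moreover have "(\<lambda>N. norm (s N) * norm x + sqrt (P * Q x)) \<longlonglongrightarrow> norm (0::'a) * norm x + sqrt (P * Q x)"
      using sums unfolding sums_def s_def by (intro tendsto_intros)
    ultimately have "norm (a m) * norm (ip x (f m)) \<le> sqrt (P * Q x)"
      by (intro LIMSEQ_le_const[where X = "\<lambda>N. norm (s N) * norm x + sqrt (P * Q x)"])
        (auto intro!: exI[of _ "Suc m"])
    then have "(norm (a m) * norm (ip x (f m)))\<^sup>2 \<le> (sqrt (P * Q x))\<^sup>2"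
      by (rule power_mono) simp
    then show ?thesis
      using \<open>P \<ge> 0\<close> Q_nonneg[of x] by (simp add: power_mult_distrib)
  qed
  \<comment> \<open>By \<open>coeff\<close>, the full sum is at most \<open>C * Q x\<close>, so
    \<open>A / C\<close> is a lower bound after the erasure.\<close>
  define C where "C = 1 + P / (norm (a m))\<^sup>2"
  have "C > 0"
    using \<open>P \<ge> 0\<close> by (simp add: C_def add_pos_nonneg)
  have lower: "A / C * (norm x)\<^sup>2 \<le> Q x" for x
  proof -
    have "(norm (ip x (f m)))\<^sup>2 \<le> P / (norm (a m))\<^sup>2 * Q x"
      using coeff[of x] \<open>a m \<noteq> 0\<close> by (simp add: field_simps)
    then have "A * (norm x)\<^sup>2 \<le> C * Q x"
      using lower_bound[of x] split[of x] by (simp add: C_def distrib_right)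
    then show ?thesis
      using \<open>C > 0\<close> by (simp add: field_simps)
  qed
  have upper: "Q x \<le> B * (norm x)\<^sup>2" for x
    using split[of x] upper_bound[of x] zero_le_power2[of "norm (ip x (f m))"] by linarith
  have "A / C > 0"
    using A_pos \<open>C > 0\<close> by simp
  then show ?thesis
    unfolding is_frame_def using B_pos lower upper summ unfolding Q_def by blast
qed

end

theorem theorem4p8:
  fixes smul :: "'k::real_or_complex \<Rightarrow> 'a::banach \<Rightarrow> 'a"
    and ip :: "'a \<Rightarrow> 'a \<Rightarrow> 'k"
    and f :: "nat \<Rightarrow> 'a"
  assumes "hilbert_space smul ip"
    and "besselian_frame smul ip f"
  shows "robust_to_1_erasure ip f \<longleftrightarrow>
    (\<exists>a :: nat \<Rightarrow> 'k. square_summable a \<and> (\<forall>i. a i \<noteq> 0) \<and>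
       (\<lambda>i. smul (a i) (f i)) sums 0)"
proof -
  have frame: "is_frame ip UNIV f"
    using assms(2) by (simp add: besselian_frame_def)
  then obtain A B where "A > 0" "B > 0" and bounds:
    "\<And>x. (\<lambda>i. (norm (ip x (f i)))\<^sup>2) summable_on UNIV"
    "\<And>x. A * (norm x)\<^sup>2 \<le> (\<Sum>\<^sub>\<infinity>i. (norm (ip x (f i)))\<^sup>2)"
    "\<And>x. (\<Sum>\<^sub>\<infinity>i. (norm (ip x (f i)))\<^sup>2) \<le> B * (norm x)\<^sup>2"
    unfolding is_frame_def by blast
  \<comment> \<open>\<open>is_frame\<close> uses unordered sums and \<open>hilbert_frame\<close>
    ordered ones; they agree because the family is summable.\<close>
  have "(\<Sum>\<^sub>\<infinity>i. (norm (ip x (f i)))\<^sup>2) = (\<Sum>i. (norm (ip x (f i)))\<^sup>2)" for x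
    by (intro sums_unique has_sum_imp_sums has_sum_infsum bounds)
  then interpret hilbert_frame smul ip f A B
    using \<open>A > 0\<close> \<open>B > 0\<close> bounds
    by (intro hilbert_frame.intro assms(1) hilbert_frame_axioms.intro)
      (auto intro: summable_on_imp_summable)
  show ?thesis
    using frame robust_imp_annihilating_coefficients annihilating_coefficients_imp_frame
    unfolding robust_to_1_erasure_def by blast
qed

end
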